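(* Let $\Omega=(-l,l)$ with $l>0$, and let $\{u^\delta\}_{\delta>0}\subset H^2(\Omega)$ satisfy the estimates $$\Bigl|\int_\Omega u^\delta\,dx\Bigr|\le c_0,\qquad \int_\Omega\sqrt{1+|u^\delta_x|^2}\,dx\le c_1,\qquad \int_\Omega\frac{|u^\delta_{xx}|^2}{\bigl(\sqrt{1+|u^\delta_x|^2}\bigr)^3}\,dx\le c_2$$ with constants $c_0,c_1,c_2$ independent of $\delta$. Then $\{u^\delta\}_{\delta>0}$ is uniformly bounded in $W^{1,\infty}(\Omega)\cap H^2(\Omega)$ independently of $\delta>0$.
   Context: Subscripts $x$ denote weak derivatives. $\{u^\delta\}_{\delta>0}$ is a family of functions indexed by the parameter $\delta$. *)

theory Defs
  imports "HOL-Analysis.Analysis" "HOL-Probability.Essential_Supremum"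
begin

text \<open>
  Sobolev spaces on an open subset of the real line. A class of functions modulo equality almost
  everywhere is represented by any function of type \<^typ>\<open>real \<Rightarrow> real\<close>; only its restriction
  to the domain matters.
\<close>

definition smooth :: "(real \<Rightarrow> real) \<Rightarrow> bool" where
  "smooth \<phi> \<longleftrightarrow> (\<forall>k x. (deriv ^^ k) \<phi> differentiable (at x))"

definition test_functions :: "real set \<Rightarrow> (real \<Rightarrow> real) set" where
  "test_functions \<Omega> =
     {\<phi>. smooth \<phi> \<and> compact (closure {x. \<phi> x \<noteq> 0}) \<and> closure {x. \<phi> x \<noteq> 0} \<subseteq> \<Omega>}"

definition locally_integrable :: "real set \<Rightarrow> (real \<Rightarrow> real) \<Rightarrow> bool" where
  "locally_integrable \<Omega> f \<longleftrightarrow> (\<forall>K. compact K \<and> K \<subseteq> \<Omega> \<longrightarrow> f absolutely_integrable_on K)"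

definition has_weak_deriv :: "real set \<Rightarrow> (real \<Rightarrow> real) \<Rightarrow> (real \<Rightarrow> real) \<Rightarrow> bool" where
  "has_weak_deriv \<Omega> u v \<longleftrightarrow>
     locally_integrable \<Omega> u \<and> locally_integrable \<Omega> v \<and>
     (\<forall>\<phi>\<in>test_functions \<Omega>.
        (LINT x:\<Omega>|lebesgue. u x * deriv \<phi> x) = - (LINT x:\<Omega>|lebesgue. v x * \<phi> x))"

definition weakly_differentiable :: "real set \<Rightarrow> (real \<Rightarrow> real) \<Rightarrow> bool" where
  "weakly_differentiable \<Omega> u \<longleftrightarrow> (\<exists>v. has_weak_deriv \<Omega> u v)"

text \<open>
  The weak derivative is unique only up to null sets, so a representative is chosen; it is
  meaningful only for weakly differentiable functions.
\<close>

definition weak_deriv :: "real set \<Rightarrow> (real \<Rightarrow> real) \<Rightarrow> real \<Rightarrow> real" where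
  "weak_deriv \<Omega> u = (SOME v. has_weak_deriv \<Omega> u v)"

text \<open>
  The exponent of a Lebesgue space is an extended nonnegative real with \<open>1 \<le> p \<le> \<infinity>\<close>.
\<close>

definition Lp_space :: "real set \<Rightarrow> ennreal \<Rightarrow> (real \<Rightarrow> real) set" where
  "Lp_space \<Omega> p =
     {f \<in> borel_measurable (lebesgue_on \<Omega>).
        if p = \<infinity> then esssup (lebesgue_on \<Omega>) (\<lambda>x. ennreal \<bar>f x\<bar>) < \<infinity>
        else integrable (lebesgue_on \<Omega>) (\<lambda>x. \<bar>f x\<bar> powr enn2real p)}"

text \<open>The following norms are real-valued and meaningful only on the respective spaces.\<close>

definition Lp_norm :: "real set \<Rightarrow> ennreal \<Rightarrow> (real \<Rightarrow> real) \<Rightarrow> real" where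
  "Lp_norm \<Omega> p f =
     (if p = \<infinity> then enn2real (esssup (lebesgue_on \<Omega>) (\<lambda>x. ennreal \<bar>f x\<bar>))
      else (LINT x|lebesgue_on \<Omega>. \<bar>f x\<bar> powr enn2real p) powr (1 / enn2real p))"

definition sobolev_space :: "real set \<Rightarrow> nat \<Rightarrow> ennreal \<Rightarrow> (real \<Rightarrow> real) set" where
  "sobolev_space \<Omega> k p =
     {u. (\<forall>j<k. weakly_differentiable \<Omega> ((weak_deriv \<Omega> ^^ j) u)) \<and>
         (\<forall>j\<le>k. (weak_deriv \<Omega> ^^ j) u \<in> Lp_space \<Omega> p)}"

definition sobolev_norm :: "real set \<Rightarrow> nat \<Rightarrow> ennreal \<Rightarrow> (real \<Rightarrow> real) \<Rightarrow> real" where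
  "sobolev_norm \<Omega> k p u = (\<Sum>j\<le>k. Lp_norm \<Omega> p ((weak_deriv \<Omega> ^^ j) u))"

end

theory Submission
  imports Defs "HOL-Computational_Algebra.Polynomial"
begin

text \<open>
  On an interval, a weakly differentiable function agrees almost everywhere with a primitive of its
  weak derivative (test functions approximate the trapezoids whose slopes pick out the values at
  two Lebesgue points). Write \<open>R = sqrt (1 + u\<^sub>x\<^sup>2)\<close>. By the chain rule and
  \<open>2 \<bar>u\<^sub>x\<^sub>x\<bar> / R \<le> u\<^sub>x\<^sub>x\<^sup>2 / R\<^sup>3 + R\<close>, the function \<open>arsinh u\<^sub>x\<close> oscillates by at most
  \<open>(c1 + c2) / 2\<close>, and at some point \<open>R\<close> is not larger than about its average. This bounds \<open>u\<^sub>x\<close>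
  uniformly; then the bound on \<open>\<integral> u\<close> controls \<open>u\<close>, and the weight \<open>R\<^sup>3\<close> in the last hypothesis is
  bounded, which controls \<open>u\<^sub>x\<^sub>x\<close> in \<open>L\<^sup>2\<close>.
\<close>

subsection \<open>Smooth cut-off functions\<close>

text \<open>For fixed \<open>w\<close>, these functions form a family closed under differentiation,
  so smoothness becomes an induction over the derivatives. With \<open>w\<close> a positive multiple
  of x (h - x) and \<open>r = 1\<close>, \<open>k = 0\<close>, this is the classical bump function
  on (0, h).\<close>

definition flat_exp :: "real poly \<Rightarrow> real poly \<Rightarrow> nat \<Rightarrow> real \<Rightarrow> real" where
  "flat_exp w r k x =
     (if poly w x > 0 then poly r x / poly w x ^ k * exp (- 1 / poly w x) else 0)"

text \<open>The single term of index \<open>k + 2\<close> in the exponential series at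
  \<open>1 / poly w x\<close> already dominates the pole of order \<open>k\<close>. The two surplus
  powers give quadratic vanishing at the zeros of \<open>w\<close>, which is what differentiability
  there requires.\<close>

lemma flat_exp_bound: "\<bar>flat_exp w r k x\<bar> \<le> fact (k + 2) * \<bar>poly r x\<bar> * (poly w x)\<^sup>2"
proof (cases "poly w x > 0")
  case True
  define y where "y = poly w x"
  have y: "y > 0" using True by (simp add: y_def)
  have "(1 / y) ^ (k + 2) / fact (k + 2) \<le> exp (1 / y)"
    using y sum_le_suminf[OF summable_exp_generic[of "1 / y"], of "{k + 2}"]
    by (simp add: exp_def divide_inverse mult.commute del: fact_Suc)
  then have "exp (- 1 / y) / y ^ k \<le> fact (k + 2) * y\<^sup>2"
    unfolding add_2_eq_Suc' using y by (simp add: exp_minus field_simps power_add power2_eq_square del: fact_Suc)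
  then have "\<bar>poly r x\<bar> * (exp (- 1 / y) / y ^ k) \<le> \<bar>poly r x\<bar> * (fact (k + 2) * y\<^sup>2)"
    by (intro mult_left_mono) auto
  then show ?thesis
    using True y by (simp add: flat_exp_def abs_mult y_def[symmetric] mult_ac)
qed (simp add: flat_exp_def)

text \<open>Away from the zeros of \<open>w\<close> this is ordinary calculus, with all terms put
  over the common denominator \<open>w ^ (k + 2)\<close>. At a zero the quadratic bound makes the
  difference quotient tend to 0, and the right-hand side is 0 there by definition.\<close>

lemma flat_exp_deriv:
  "(flat_exp w r k has_real_derivative
     flat_exp w (pderiv r * w\<^sup>2 - of_nat k * r * pderiv w * w + r * pderiv w) (k + 2) x) (at x)"
proof -
  consider "poly w x > 0" | "poly w x < 0" | "poly w x = 0" by linarith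
  then show ?thesis
  proof cases
    case 1
    let ?g = "\<lambda>x. poly r x / poly w x ^ k * exp (- 1 / poly w x)"
    define W R W' R' e where "W = poly w x" and "R = poly r x" and "W' = poly (pderiv w) x"
      and "R' = poly (pderiv r) x" and "e = exp (- 1 / W)"
    note abbr = this
    have W: "W > 0" using 1 by (simp add: abbr)
    have inv: "((\<lambda>x. 1 / poly w x) has_real_derivative - W' / W\<^sup>2) (at x)"
      using DERIV_inverse_fun[OF poly_DERIV[of w x]] W
      by (simp add: abbr divide_inverse power2_eq_square mult_ac)
    have "((\<lambda>x. poly r x * (1 / poly w x) ^ k * exp (- (1 / poly w x))) has_real_derivative
        (R' * (1 / W) ^ k + of_nat k * (1 / W) ^ (k - 1) * (- W' / W\<^sup>2) * R) * e
          + e * (W' / W\<^sup>2) * (R * (1 / W) ^ k)) (at x)"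
      by (rule derivative_eq_intros inv poly_DERIV refl)+ (simp add: abbr)
    \<comment> \<open>The power rule leaves the exponent \<open>k - 1\<close>, truncated at
      \<open>k = 0\<close>. In that case the factor \<open>of_nat k\<close> vanishes, so the
      equation holds for every \<open>k\<close>.\<close>
    moreover have "of_nat k * (1 / W) ^ (k - 1) * (- W' / W\<^sup>2) = - of_nat k * W' / W ^ (k + 1)"
      using W by (cases k) (simp_all add: power_divide power2_eq_square field_simps)
    ultimately have "((\<lambda>x. poly r x * (1 / poly w x) ^ k * exp (- (1 / poly w x))) has_real_derivative
        (R' * (1 / W) ^ k + - of_nat k * W' / W ^ (k + 1) * R) * e
          + e * (W' / W\<^sup>2) * (R * (1 / W) ^ k)) (at x)"
      by (simp only:)
    also have "(R' * (1 / W) ^ k + - of_nat k * W' / W ^ (k + 1) * R) * e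
          + e * (W' / W\<^sup>2) * (R * (1 / W) ^ k)
        = (R' * W\<^sup>2 - of_nat k * R * W' * W + R * W') / W ^ (k + 2) * e"
    proof -
      have "W ^ k \<noteq> 0" using W by simp
      then show ?thesis using W
        by (simp add: power_divide power_add divide_simps) (simp add: algebra_simps power2_eq_square)
    qed
    also have "\<dots> = flat_exp w (pderiv r * w\<^sup>2 - of_nat k * r * pderiv w * w + r * pderiv w) (k + 2) x"
      using 1 by (simp add: flat_exp_def abbr)
    finally have D: "(?g has_real_derivative
        flat_exp w (pderiv r * w\<^sup>2 - of_nat k * r * pderiv w * w + r * pderiv w) (k + 2) x) (at x)"
      by (simp add: power_divide)
    have "\<forall>\<^sub>F y in nhds x. poly w y > 0"
      by (rule order_tendstoD[OF _ 1]) (intro tendsto_intros filterlim_ident)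
    then have ev: "\<forall>\<^sub>F y in nhds x. flat_exp w r k y = ?g y"
      by eventually_elim (simp add: flat_exp_def)
    show ?thesis
      by (rule DERIV_cong_ev[OF refl ev refl, THEN iffD2, OF D])
  next
    case 2
    have "\<forall>\<^sub>F y in nhds x. poly w y < 0"
      by (rule order_tendstoD[OF _ 2]) (intro tendsto_intros filterlim_ident)
    then have ev: "\<forall>\<^sub>F y in nhds x. flat_exp w r k y = 0"
      by eventually_elim (simp add: flat_exp_def)
    have "(flat_exp w r k has_real_derivative 0) (at x)"
      by (rule DERIV_cong_ev[OF refl ev refl, THEN iffD2]) simp
    then show ?thesis
      using 2 by (simp add: flat_exp_def)
  next
    case 3
    \<comment> \<open>Splitting off the linear factor exhibits two powers of
      \<open>\<bar>y - x\<bar>\<close> in the square of \<open>w\<close>: one cancels the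
      denominator of the difference quotient, the other sends it to 0.\<close>
    then obtain w1 where w1: "w = [:- x, 1:] * w1"
      unfolding poly_eq_0_iff_dvd by (auto elim: dvdE)
    let ?B = "\<lambda>y. fact (k + 2) * \<bar>poly r y\<bar> * (poly w1 y)\<^sup>2 * \<bar>y - x\<bar>"
    have "(?B \<longlongrightarrow> fact (k + 2) * \<bar>poly r x\<bar> * (poly w1 x)\<^sup>2 * \<bar>x - x\<bar>) (at x)"
      by (intro tendsto_intros)
    then have B: "(?B \<longlongrightarrow> 0) (at x)" by simp
    have "\<bar>flat_exp w r k y / (y - x)\<bar> \<le> ?B y" if "y \<noteq> x" for y
    proof -
      have "(poly w y)\<^sup>2 = (poly w1 y)\<^sup>2 * (\<bar>y - x\<bar> * \<bar>y - x\<bar>)"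
        unfolding abs_mult_self_eq w1 by (simp add: power2_eq_square algebra_simps)
      then have "\<bar>flat_exp w r k y\<bar> \<le> ?B y * \<bar>y - x\<bar>"
        using flat_exp_bound[of w r k y] by (simp add: mult.assoc)
      then show ?thesis using that by (simp add: abs_divide divide_le_eq)
    qed
    then have "\<forall>\<^sub>F y in at x. norm (flat_exp w r k y / (y - x)) \<le> ?B y"
      by (auto simp: eventually_at_filter)
    then have "((\<lambda>y. flat_exp w r k y / (y - x)) \<longlongrightarrow> 0) (at x)"
      using B by (rule Lim_null_comparison)
    then show ?thesis
      using 3 by (simp add: has_field_derivative_iff flat_exp_def)
  qed
qed

lemma smooth_flat_exp: "smooth (flat_exp w r k)"
proof -
  have "\<exists>r' k'. (deriv ^^ n) (flat_exp w r k) = flat_exp w r' k'" for n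
  proof (induction n)
    case (Suc n)
    then obtain r' k' where "(deriv ^^ n) (flat_exp w r k) = flat_exp w r' k'" by blast
    then have "(deriv ^^ Suc n) (flat_exp w r k) = deriv (flat_exp w r' k')" by simp
    also have "\<dots> = flat_exp w
        (pderiv r' * w\<^sup>2 - of_nat k' * r' * pderiv w * w + r' * pderiv w) (k' + 2)"
      by (rule ext) (rule DERIV_imp_deriv[OF flat_exp_deriv])
    finally show ?case by blast
  qed auto
  then show ?thesis
    unfolding smooth_def by (metis flat_exp_deriv real_differentiable_def)
qed

section \<open>Closure properties of smooth functions, and smooth ramps\<close>

lemma smooth_antiderivative:
  assumes "\<And>x. (F has_real_derivative f x) (at x)" and "smooth f"
  shows "smooth F"
  unfolding smooth_def
proof (intro allI)
  fix k x
  have "deriv F = f" using assms(1) DERIV_imp_deriv by blast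
  then show "(deriv ^^ k) F differentiable at x"
    using assms by (cases k) (auto simp: smooth_def funpow_Suc_right real_differentiable_def
        simp del: funpow.simps)
qed

lemma smooth_diff:
  assumes f: "smooth f" and g: "smooth g"
  shows "smooth (\<lambda>x. f x - g x)"
proof -
  have "(deriv ^^ k) (\<lambda>x. f x - g x) = (\<lambda>x. (deriv ^^ k) f x - (deriv ^^ k) g x)" for k
  proof (induction k)
    case (Suc k)
    have "deriv (\<lambda>x. (deriv ^^ k) f x - (deriv ^^ k) g x) x =
        deriv ((deriv ^^ k) f) x - deriv ((deriv ^^ k) g) x" for x
      using f g by (intro deriv_diff)
        (auto simp: smooth_def field_differentiable_def real_differentiable_def)
    with Suc show ?case by auto
  qed auto
  with f g show ?thesis by (auto simp: smooth_def intro!: differentiable_diff)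
qed

lemma smooth_shift:
  assumes f: "smooth f"
  shows "smooth (\<lambda>x. f (x - c))"
proof -
  have "(deriv ^^ k) (\<lambda>x. f (x - c)) = (\<lambda>x. (deriv ^^ k) f (x - c))" for k
  proof (induction k)
    case (Suc k)
    have "deriv (\<lambda>x. (deriv ^^ k) f (x - c)) x = deriv ((deriv ^^ k) f) (x - c)" for x
    proof -
      have "((deriv ^^ k) f has_real_derivative deriv ((deriv ^^ k) f) (x - c)) (at (x - c))"
        using f unfolding smooth_def
        by (metis DERIV_imp_deriv real_differentiable_def)
      then have "((\<lambda>x. (deriv ^^ k) f (x - c)) has_real_derivative
          deriv ((deriv ^^ k) f) (x - c) * 1) (at x)"
        by (intro DERIV_chain2[where g = "\<lambda>x. x - c"]) (auto intro!: derivative_eq_intros)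
      then show ?thesis by (simp add: DERIV_imp_deriv)
    qed
    with Suc show ?case by auto
  qed auto
  moreover have "(\<lambda>x. g (x - c)) differentiable at x" if "\<And>x. g differentiable at x"
    for g :: "real \<Rightarrow> real" and x
    using that[of "x - c"] differentiable_compose[where f = g and g = "\<lambda>x. x - c" and x = x and s = UNIV] by auto
  ultimately show ?thesis using f by (auto simp: smooth_def)
qed

text \<open>The bumps \<open>f n\<close>, equal to exp (- 1 / ((n + 1) x (h - x))) on (0, h), tend
  to 1 there, since the growing factor drives the exponent to 0. Their primitives \<open>F n\<close>
  vanish left of 0 and are constant right of \<open>h\<close>, so the difference of two translates
  has compact support; such differences serve as test functions.\<close>

lemma smooth_ramp:
  fixes h :: real
  assumes h: "h > 0"
  obtains F f :: "nat \<Rightarrow> real \<Rightarrow> real" where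
    "\<And>n. smooth (F n)" "\<And>n x. (F n has_real_derivative f n x) (at x)"
    "\<And>n. continuous_on UNIV (f n)" "\<And>n x. 0 \<le> f n x" "\<And>n x. f n x \<le> 1"
    "\<And>x. (\<lambda>n. f n x) \<longlonglongrightarrow> indicator {0<..<h} x"
    "\<And>n x. x \<le> 0 \<Longrightarrow> F n x = 0" "\<And>n x. x \<ge> h \<Longrightarrow> F n x = F n h"
    "\<And>n x. 0 \<le> F n x" "\<And>n x. F n x \<le> h"
    "\<And>x. (\<lambda>n. F n x) \<longlonglongrightarrow> max 0 (min h x)"
proof -
  define w where "w n = smult (real (Suc n)) [:0, h, -1:]" for n
  define f where "f n = flat_exp (w n) 1 0" for n
  have w: "poly (w n) x = real (Suc n) * (x * (h - x))" for n x
    by (simp add: w_def algebra_simps)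
  have w_pos: "poly (w n) x > 0 \<longleftrightarrow> 0 < x \<and> x < h" for n x
    using h unfolding w by (auto simp: zero_less_mult_iff)
  have f: "f n x = (if 0 < x \<and> x < h then exp (- 1 / (real (Suc n) * (x * (h - x)))) else 0)" for n x
    unfolding f_def flat_exp_def w_pos by (simp add: w)
  have f_nonneg: "0 \<le> f n x" for n x by (simp add: f)
  have f_le: "f n x \<le> 1" for n x by (simp add: f)
  have f_smooth: "smooth (f n)" for n by (simp add: f_def smooth_flat_exp)
  have f_cont: "isCont (f n) x" for n x
    unfolding f_def by (rule DERIV_isCont[OF flat_exp_deriv])
  have f_lim: "(\<lambda>n. f n x) \<longlonglongrightarrow> indicator {0<..<h} x" for x
  proof (cases "0 < x \<and> x < h")
    case True
    have "(\<lambda>n. - 1 / (x * (h - x)) * (1 / real (Suc n))) \<longlonglongrightarrow> - 1 / (x * (h - x)) * 0"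
      by (intro tendsto_intros LIMSEQ_Suc[OF lim_1_over_n])
    then have "(\<lambda>n. exp (- 1 / (x * (h - x)) * (1 / real (Suc n)))) \<longlonglongrightarrow> exp 0"
      by (intro tendsto_exp) simp
    moreover have "f n x = exp (- 1 / (x * (h - x)) * (1 / real (Suc n)))" for n
      using True by (simp add: f mult.commute)
    ultimately show ?thesis using True by simp
  qed (auto simp: f)
  \<comment> \<open>The interval is taken to be the whole line, so that the primitive has its
    derivative at every real point, as \<open>smooth\<close> demands.\<close>
  have "\<exists>G. \<forall>x::real. - \<infinity> < ereal x \<longrightarrow> ereal x < \<infinity> \<longrightarrow> (G has_vector_derivative f n x) (at x)" for n
    by (rule einterval_antiderivative) (auto simp: f_cont)
  then have "\<forall>n. \<exists>G. \<forall>x. (G has_vector_derivative f n x) (at x)"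
    by simp
  then obtain G where G: "\<And>n x. (G n has_real_derivative f n x) (at x)"
    unfolding has_real_derivative_iff_has_vector_derivative
    by metis
  define F where "F n x = G n x - G n 0" for n x
  have F: "(F n has_real_derivative f n x) (at x)" for n x
    unfolding F_def using G by (auto intro!: derivative_eq_intros)
  have ftc: "(f n has_integral F n y - F n x) {x..y}" if "x \<le> y" for n x y
    using that F by (intro fundamental_theorem_of_calculus)
      (auto simp flip: has_real_derivative_iff_has_vector_derivative intro: DERIV_subset)
  have F0: "F n 0 = 0" for n by (simp add: F_def)
  have F_left: "F n x = 0" if "x \<le> 0" for n x
  proof -
    have "(f n has_integral 0) {x..0}"
      by (rule has_integral_is_0) (auto simp: f)
    then show ?thesis using has_integral_unique[OF ftc[OF that]] F0 by force
  qed
  have F_right: "F n x = F n h" if "x \<ge> h" for n x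
  proof -
    have "(f n has_integral 0) {h..x}"
      by (rule has_integral_is_0) (auto simp: f)
    then show ?thesis using has_integral_unique[OF ftc[OF that]] by force
  qed
  have F_nonneg: "0 \<le> F n x" for n x
  proof (cases "x \<le> 0")
    case False
    then show ?thesis using has_integral_nonneg[OF ftc[of 0 x n]] f_nonneg F0 by auto
  qed (simp add: F_left)
  have F_le': "F n x \<le> h" if "0 \<le> x" "x \<le> h" for n x
  proof -
    have "F n x - F n 0 \<le> 1 * (x - 0)"
      using has_integral_le[OF ftc[OF that(1)] has_integral_const_real[of 1 0 x]] f_le that by auto
    then show ?thesis using that F0 by simp
  qed
  have F_le: "F n x \<le> h" for n x
    using F_le'[of x n] F_le'[of h n] F_left[of x n] F_right[of x n] h by linarith
  have F_lim': "(\<lambda>n. F n m) \<longlonglongrightarrow> m" if m: "0 \<le> m" "m \<le> h" for m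
  proof -
    have "((\<lambda>x. 1) has_integral m) {0..m}"
      using has_integral_const_real[of "1 :: real" 0 m] m by simp
    \<comment> \<open>On \<open>{0..m}\<close> the indicator differs from 1 only at 0 and, if
      \<open>m = h\<close>, at \<open>m\<close>.\<close>
    then have "(indicator {0<..<h} has_integral m) {0..m}"
      by (rule has_integral_spike_finite[of "{0, m}", rotated 2]) (use m in auto)
    moreover have "(\<lambda>n. integral {0..m} (f n)) \<longlonglongrightarrow> integral {0..m} (indicator {0<..<h})"
    proof (rule dominated_convergence(2))
      show "f n integrable_on {0..m}" for n
        using ftc[OF m(1)] by blast
      show "(\<lambda>x. 1 :: real) integrable_on {0..m}" by (rule integrable_const_ivl)
      show "norm (f n x) \<le> 1" for n x using f_nonneg f_le by simp
    qed (rule f_lim)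
    moreover have "integral {0..m} (f n) = F n m" for n
      using ftc[OF m(1)] F0 by (simp add: integral_unique)
    ultimately show ?thesis by (simp add: integral_unique)
  qed
  have F_lim: "(\<lambda>n. F n x) \<longlonglongrightarrow> max 0 (min h x)" for x
    using F_lim'[of x] F_lim'[of h] h F_left[of x] F_right[of x]
    by (cases "x \<le> 0"; cases "x \<ge> h") auto
  show thesis
  proof (rule that[of F f])
    show "smooth (F n)" for n
      using F f_smooth by (rule smooth_antiderivative)
    show "continuous_on UNIV (f n)" for n
      using f_cont by (intro continuous_at_imp_continuous_on) auto
  qed (fact F f_nonneg f_le f_lim F_left F_right F_nonneg F_le F_lim)+
qed

subsection \<open>Weak derivatives and primitives\<close>

lemma absolutely_integrable_mult_continuous_bounded:
  fixes f g :: "real \<Rightarrow> real"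
  assumes "f absolutely_integrable_on S" "S \<in> sets lebesgue" "continuous_on S g"
    and "\<And>x. x \<in> S \<Longrightarrow> \<bar>g x\<bar> \<le> B"
  shows "(\<lambda>x. f x * g x) absolutely_integrable_on S"
proof -
  have "bounded (g ` S)" using assms(4) by (auto simp: bounded_iff)
  then show ?thesis
    using absolutely_integrable_bounded_measurable_product_real[of g S f] assms
    by (simp add: continuous_imp_measurable_on_sets_lebesgue mult.commute)
qed

text \<open>The trapezoid is not smooth, so it is approximated by test functions
  \<open>\<phi> n\<close>, differences of smooth ramps starting at \<open>s\<close> and
  \<open>t\<close>. Their derivatives tend to the difference of the indicators of (s, s + h) and (t,
  t + h), and dominated convergence carries integration by parts to the limit on both sides.\<close>

lemma weak_deriv_trapezoid:
  assumes wd: "has_weak_deriv {a<..<b} u v"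
    and u: "u absolutely_integrable_on {a<..<b}" and v: "v absolutely_integrable_on {a<..<b}"
    and st: "a < s" "s + h < b" "a < t" "t + h < b" and h: "0 < h"
  shows "integral {s..s+h} u - integral {t..t+h} u =
    - integral {a<..<b} (\<lambda>x. v x * (max 0 (min h (x - s)) - max 0 (min h (x - t))))"
proof -
  let ?\<Omega> = "{a<..<b}"
  obtain F f where F: "\<And>n. smooth (F n)" "\<And>n x. (F n has_real_derivative f n x) (at x)"
    "\<And>n. continuous_on UNIV (f n)" "\<And>n x. 0 \<le> f n x" "\<And>n x. f n x \<le> 1"
    "\<And>x. (\<lambda>n. f n x) \<longlonglongrightarrow> indicator {0<..<h} x"
    "\<And>n x. x \<le> 0 \<Longrightarrow> F n x = 0" "\<And>n x. x \<ge> h \<Longrightarrow> F n x = F n h"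
    "\<And>n x. 0 \<le> F n x" "\<And>n x. F n x \<le> h"
    "\<And>x. (\<lambda>n. F n x) \<longlonglongrightarrow> max 0 (min h x)"
    using smooth_ramp[OF h] by blast
  define \<phi> where "\<phi> n x = F n (x - s) - F n (x - t)" for n x
  define \<psi> where "\<psi> n x = f n (x - s) - f n (x - t)" for n x
  have \<phi>_deriv: "(\<phi> n has_real_derivative \<psi> n x) (at x)" for n x
  proof -
    have "((\<lambda>x. F n (x - r)) has_real_derivative f n (x - r) * 1) (at x)" for r
      by (rule DERIV_chain2[OF F(2)]) (auto intro!: derivative_eq_intros)
    then show ?thesis
      unfolding \<phi>_def \<psi>_def by (intro DERIV_diff) simp_all
  qed
  have \<phi>_test: "\<phi> n \<in> test_functions ?\<Omega>" for n
  proof -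
    have "{x. \<phi> n x \<noteq> 0} \<subseteq> {min s t..max s t + h}"
    proof
      fix x assume x: "x \<in> {x. \<phi> n x \<noteq> 0}"
      have "\<phi> n x = 0" if "x \<le> min s t" using that by (simp add: \<phi>_def F(7))
      then have "\<not> x \<le> min s t" using x by blast
      \<comment> \<open>To the right of both ramps the two plateaus have the same height
        \<open>F n h\<close> and cancel.\<close>
      moreover have "\<phi> n x = 0" if "x \<ge> max s t + h"
        using that F(8)[of "x - s" n] F(8)[of "x - t" n] by (simp add: \<phi>_def)
      then have "\<not> x \<ge> max s t + h" using x by blast
      ultimately show "x \<in> {min s t..max s t + h}"
        unfolding atLeastAtMost_iff by linarith
    qed
    then have sub: "closure {x. \<phi> n x \<noteq> 0} \<subseteq> {min s t..max s t + h}"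
      by (intro closure_minimal) auto
    then have "compact (closure {x. \<phi> n x \<noteq> 0})"
      using bounded_subset[OF bounded_closed_interval] by (auto simp: compact_eq_bounded_closed)
    moreover have "smooth (\<phi> n)"
      unfolding \<phi>_def by (intro smooth_diff smooth_shift F(1))
    moreover have "{min s t..max s t + h} \<subseteq> ?\<Omega>" using st by auto
    ultimately show ?thesis using sub by (auto simp: test_functions_def)
  qed
  have \<psi>_cont: "continuous_on ?\<Omega> (\<psi> n)" for n
    unfolding \<psi>_def
    by (intro continuous_intros continuous_on_compose2[OF F(3)]) auto
  have \<phi>_cont: "continuous_on ?\<Omega> (\<phi> n)" for n
    by (meson \<phi>_deriv DERIV_isCont continuous_at_imp_continuous_on)
  have \<psi>_bd: "\<bar>\<psi> n x\<bar> \<le> 1" for n x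
    using F(4,5)[of n "x - s"] F(4,5)[of n "x - t"] by (auto simp: \<psi>_def)
  have \<phi>_bd: "\<bar>\<phi> n x\<bar> \<le> h" for n x
    using F(9,10)[of n "x - s"] F(9,10)[of n "x - t"] by (auto simp: \<phi>_def)
  have iu: "(\<lambda>x. u x * \<psi> n x) absolutely_integrable_on ?\<Omega>" for n
    using \<psi>_bd by (intro absolutely_integrable_mult_continuous_bounded[OF u _ \<psi>_cont]) auto
  have iv: "(\<lambda>x. v x * \<phi> n x) absolutely_integrable_on ?\<Omega>" for n
    using \<phi>_bd by (intro absolutely_integrable_mult_continuous_bounded[OF v _ \<phi>_cont]) auto
  have parts: "integral ?\<Omega> (\<lambda>x. u x * \<psi> n x) = - integral ?\<Omega> (\<lambda>x. v x * \<phi> n x)" for n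
  proof -
    have "deriv (\<phi> n) = \<psi> n" using \<phi>_deriv DERIV_imp_deriv by blast
    then have "(LINT x:?\<Omega>|lebesgue. u x * \<psi> n x) = - (LINT x:?\<Omega>|lebesgue. v x * \<phi> n x)"
      using wd \<phi>_test unfolding has_weak_deriv_def by metis
    then show ?thesis
      using set_lebesgue_integral_eq_integral(2)[OF iu] set_lebesgue_integral_eq_integral(2)[OF iv]
      by simp
  qed
  have absu: "(\<lambda>x. \<bar>u x\<bar>) integrable_on ?\<Omega>" and absv: "(\<lambda>x. \<bar>v x\<bar>) integrable_on ?\<Omega>"
    using u v by (auto simp: absolutely_integrable_on_def)
  let ?g = "\<lambda>x. indicator {0<..<h} (x - s) - indicator {0<..<h} (x - t) :: real"
  have lim_u: "(\<lambda>n. integral ?\<Omega> (\<lambda>x. u x * \<psi> n x)) \<longlonglongrightarrow> integral ?\<Omega> (\<lambda>x. u x * ?g x)"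
  proof (rule dominated_convergence(2)[OF _ absu])
    show "(\<lambda>x. u x * \<psi> n x) integrable_on ?\<Omega>" for n
      using iu by (simp add: absolutely_integrable_on_def)
    show "norm (u x * \<psi> n x) \<le> \<bar>u x\<bar>" for n x
      using \<psi>_bd[of n x] by (simp add: abs_mult mult_left_le)
    show "(\<lambda>n. u x * \<psi> n x) \<longlonglongrightarrow> u x * ?g x" for x
      unfolding \<psi>_def by (intro tendsto_intros F(6))
  qed
  have lim_v: "(\<lambda>n. integral ?\<Omega> (\<lambda>x. v x * \<phi> n x)) \<longlonglongrightarrow>
      integral ?\<Omega> (\<lambda>x. v x * (max 0 (min h (x - s)) - max 0 (min h (x - t))))"
  proof (rule dominated_convergence(2))
    show "(\<lambda>x. \<bar>v x\<bar> * h) integrable_on ?\<Omega>"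
      using absv by (rule integrable_on_mult_left)
    show "(\<lambda>x. v x * \<phi> n x) integrable_on ?\<Omega>" for n
      using iv by (simp add: absolutely_integrable_on_def)
    show "norm (v x * \<phi> n x) \<le> \<bar>v x\<bar> * h" for n x
      using \<phi>_bd[of n x] by (simp add: abs_mult mult_left_mono)
    show "(\<lambda>n. v x * \<phi> n x) \<longlonglongrightarrow> v x * (max 0 (min h (x - s)) - max 0 (min h (x - t)))" for x
      unfolding \<phi>_def by (intro tendsto_intros F(11))
  qed
  have piece: "((\<lambda>x. u x * indicator {0<..<h} (x - r)) has_integral integral {r..r+h} u) ?\<Omega>"
    if r: "a < r" "r + h < b" for r
  proof -
    have "u integrable_on {r..r+h}"
      using r u by (intro integrable_on_subinterval[of u ?\<Omega>]) (auto simp: absolutely_integrable_on_def)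
    then have "(u has_integral integral {r..r+h} u) {r..r+h}" by (rule integrable_integral)
    then have "((\<lambda>x. u x * indicator {0<..<h} (x - r)) has_integral integral {r..r+h} u) {r..r+h}"
      by (rule has_integral_spike_finite[of "{r, r + h}", rotated 2]) auto
    then show ?thesis
      by (rule has_integral_on_superset) (use r in \<open>auto split: split_indicator\<close>)
  qed
  have "integral ?\<Omega> (\<lambda>x. u x * ?g x) = integral {s..s+h} u - integral {t..t+h} u"
    using has_integral_diff[OF piece[OF st(1,2)] piece[OF st(3,4)]]
    by (simp add: right_diff_distrib integral_unique)
  moreover have "integral ?\<Omega> (\<lambda>x. u x * ?g x) =
      - integral ?\<Omega> (\<lambda>x. v x * (max 0 (min h (x - s)) - max 0 (min h (x - t))))"
    by (rule LIMSEQ_unique[OF lim_u]) (use tendsto_minus[OF lim_v] in \<open>simp add: parts\<close>)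
  ultimately show ?thesis by simp
qed

text \<open>Divide the trapezoid identity by \<open>h\<close> and let \<open>h\<close> tend to 0. At
  Lebesgue points the averages of \<open>u\<close> tend to its values, while the trapezoid tends to
  the indicator of the interval from \<open>s\<close> to \<open>t\<close>. The set \<open>N\<close>
  of exceptional points does not depend on the pair \<open>s\<close>, \<open>t\<close>.\<close>

lemma weak_deriv_imp_integral:
  assumes wd: "has_weak_deriv {a<..<b} u v"
    and u: "u absolutely_integrable_on {a<..<b}" and v: "v absolutely_integrable_on {a<..<b}"
  obtains N where "negligible N"
    "\<And>s t. s \<in> {a<..<b} - N \<Longrightarrow> t \<in> {a<..<b} - N \<Longrightarrow> s \<le> t \<Longrightarrow> u t - u s = integral {s..t} v"
proof -
  let ?\<Omega> = "{a<..<b}"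
  \<comment> \<open>Extension by 0 makes the function integrable on every box, including boxes that
    leave the interval, so that the Lebesgue differentiation theorem applies on the line.\<close>
  let ?u = "\<lambda>x. if x \<in> ?\<Omega> then u x else 0"
  have "?u integrable_on UNIV"
    using u unfolding integrable_restrict_UNIV by (simp add: absolutely_integrable_on_def)
  then have "?u integrable_on cbox x y" for x y
    by (rule integrable_on_subcbox) auto
  then obtain N where N: "negligible N"
    "\<And>x e. \<lbrakk>x \<notin> N; 0 < e\<rbrakk> \<Longrightarrow> \<exists>d>0. \<forall>h. 0 < h \<and> h < d \<longrightarrow>
        norm (integral (cbox x (x + h *\<^sub>R One)) ?u /\<^sub>R h ^ DIM(real) - ?u x) < e"
    using integrable_ccontinuous_explicit[of ?u] by blast
  have "u t - u s = integral {s..t} v" if s: "s \<in> ?\<Omega> - N" and t: "t \<in> ?\<Omega> - N" and le: "s \<le> t" for s t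
  proof -
    \<comment> \<open>These lengths tend to 0 and keep \<open>t + h n\<close> below
      \<open>b\<close>; as \<open>s \<le> t\<close>, they fit to the right of \<open>s\<close> as
      well.\<close>
    define h where "h n = (b - t) / 2 * (1 / real (Suc n))" for n
    have h_pos: "h n > 0" for n using t by (simp add: h_def)
    have h_le: "t + h n < b" for n
    proof -
      have "h n \<le> (b - t) / 2 * 1"
        unfolding h_def using t by (intro mult_left_mono) auto
      then show ?thesis using t by simp
    qed
    have "h \<longlonglongrightarrow> (b - t) / 2 * 0"
      unfolding h_def by (intro tendsto_intros LIMSEQ_Suc[OF lim_1_over_n])
    then have h_lim: "h \<longlonglongrightarrow> 0" by simp
    have avg: "(\<lambda>n. integral {r..r + h n} u / h n) \<longlonglongrightarrow> u r" if r: "r \<in> ?\<Omega> - N" "r \<le> t" for r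
    proof (rule LIMSEQ_I)
      fix e :: real assume e: "0 < e"
      obtain d where d: "d > 0" "\<And>h. 0 < h \<Longrightarrow> h < d \<Longrightarrow>
          norm (integral (cbox r (r + h *\<^sub>R One)) ?u /\<^sub>R h ^ DIM(real) - ?u r) < e"
        using N(2)[of r e] r e by blast
      obtain n0 where n0: "\<And>n. n \<ge> n0 \<Longrightarrow> h n < d"
        using order_tendstoD(2)[OF h_lim d(1)] by (auto simp: eventually_sequentially)
      have "norm (integral {r..r + h n} u / h n - u r) < e" if n: "n \<ge> n0" for n
      proof -
        have "integral {r..r + h n} ?u = integral {r..r + h n} u"
          by (rule integral_cong) (use r h_le[of n] in auto)
        then show ?thesis
          using d(2)[OF h_pos n0[OF n]] r by (simp add: divide_inverse mult.commute)
      qed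
      then show "\<exists>n0. \<forall>n\<ge>n0. norm (integral {r..r + h n} u / h n - u r) < e" by blast
    qed
    \<comment> \<open>Ramps normalised to height 1, so that \<open>\<bar>v x\<bar>\<close> dominates
      the integrands for all \<open>n\<close>.\<close>
    define g where "g n r x = max 0 (min (h n) (x - r)) / h n" for n r x
    have g_bd: "0 \<le> g n r x" "g n r x \<le> 1" for n r x
      using h_pos[of n] by (auto simp: g_def)
    have g_lim: "(\<lambda>n. g n r x) \<longlonglongrightarrow> indicator {r<..} x" for r x
    proof (cases "x > r")
      case True
      then have "\<forall>\<^sub>F n in sequentially. h n < x - r"
        using order_tendstoD(2)[OF h_lim] by simp
      then have "\<forall>\<^sub>F n in sequentially. g n r x = 1"
        by eventually_elim (use True h_pos in \<open>simp add: g_def less_imp_neq[symmetric]\<close>)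
      then show ?thesis using True by (simp add: tendsto_eventually)
    qed (simp add: g_def)
    have g_cont: "continuous_on ?\<Omega> (g n r)" for n r
      unfolding g_def by (intro continuous_intros) (use h_pos[of n] in auto)
    have eq: "integral {s..s + h n} u / h n - integral {t..t + h n} u / h n =
        - integral ?\<Omega> (\<lambda>x. v x * (g n s x - g n t x))" for n
    proof -
      have "integral {s..s + h n} u - integral {t..t + h n} u =
          - integral ?\<Omega> (\<lambda>x. v x * (max 0 (min (h n) (x - s)) - max 0 (min (h n) (x - t))))"
        by (rule weak_deriv_trapezoid[OF wd u v]) (use s t le h_le[of n] h_pos in auto)
      also have "\<dots> = - integral ?\<Omega> (\<lambda>x. h n * (v x * (g n s x - g n t x)))"
        by (intro arg_cong[where f = uminus] integral_cong)
          (use h_pos[of n] in \<open>simp add: g_def field_simps\<close>)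
      also have "\<dots> = h n * - integral ?\<Omega> (\<lambda>x. v x * (g n s x - g n t x))"
        by simp
      finally show ?thesis using h_pos[of n] by (simp add: field_simps)
    qed
    let ?g = "\<lambda>x. indicator {s<..} x - indicator {t<..} x :: real"
    have "(\<lambda>n. integral ?\<Omega> (\<lambda>x. v x * (g n s x - g n t x))) \<longlonglongrightarrow> integral ?\<Omega> (\<lambda>x. v x * ?g x)"
    proof (rule dominated_convergence(2))
      show "(\<lambda>x. \<bar>v x\<bar>) integrable_on ?\<Omega>"
        using v by (auto simp: absolutely_integrable_on_def)
      have bd: "\<bar>g n s x - g n t x\<bar> \<le> 1" for n x
        using g_bd[of n s x] g_bd[of n t x] by auto
      have "(\<lambda>x. v x * (g n s x - g n t x)) absolutely_integrable_on ?\<Omega>" for n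
        by (rule absolutely_integrable_mult_continuous_bounded[OF v _ _ bd])
          (auto intro!: continuous_intros g_cont)
      then show "(\<lambda>x. v x * (g n s x - g n t x)) integrable_on ?\<Omega>" for n
        by (simp add: absolutely_integrable_on_def)
      show "norm (v x * (g n s x - g n t x)) \<le> \<bar>v x\<bar>" for n x
        using bd[of n x] by (simp add: abs_mult mult_left_le)
      show "(\<lambda>n. v x * (g n s x - g n t x)) \<longlonglongrightarrow> v x * ?g x" for x
        by (intro tendsto_intros g_lim)
    qed
    then have "(\<lambda>n. - integral ?\<Omega> (\<lambda>x. v x * (g n s x - g n t x))) \<longlonglongrightarrow> - integral ?\<Omega> (\<lambda>x. v x * ?g x)"
      by (rule tendsto_minus)
    moreover have "(\<lambda>n. - integral ?\<Omega> (\<lambda>x. v x * (g n s x - g n t x))) \<longlonglongrightarrow> u s - u t"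
      using tendsto_diff[OF avg avg, of s t] s t le by (simp add: eq)
    ultimately have "u s - u t = - integral ?\<Omega> (\<lambda>x. v x * ?g x)"
      by (rule LIMSEQ_unique[symmetric])
    moreover have "integral ?\<Omega> (\<lambda>x. v x * ?g x) = integral {s..t} v"
    proof (rule integral_unique)
      have "v integrable_on {s..t}"
        using s t v by (intro integrable_on_subinterval[of v ?\<Omega>]) (auto simp: absolutely_integrable_on_def)
      then have "(v has_integral integral {s..t} v) {s..t}" by (rule integrable_integral)
      then have "((\<lambda>x. v x * ?g x) has_integral integral {s..t} v) {s..t}"
        by (rule has_integral_spike_finite[of "{s, t}", rotated 2]) auto
      then show "((\<lambda>x. v x * ?g x) has_integral integral {s..t} v) ?\<Omega>"
        by (rule has_integral_on_superset) (use s t le in \<open>auto split: split_indicator\<close>)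
    qed
    ultimately show ?thesis by simp
  qed
  with N(1) show thesis by (rule that)
qed

text \<open>The identity between pairs of points is normalised at one base point \<open>s\<close>
  outside the null set, with \<open>c = u s - integral {a..s} v\<close>. If there is no such point,
  which happens only for an empty interval, the claim is vacuous and \<open>c = 0\<close> is an
  arbitrary choice.\<close>

lemma weak_deriv_eq_integral:
  assumes wd: "has_weak_deriv {a<..<b} u v"
    and u: "u absolutely_integrable_on {a<..<b}" and v: "v absolutely_integrable_on {a<..<b}"
  obtains N c where "negligible N" "\<And>t. t \<in> {a<..<b} - N \<Longrightarrow> u t = c + integral {a..t} v"
proof -
  obtain N where N: "negligible N"
    "\<And>s t. s \<in> {a<..<b} - N \<Longrightarrow> t \<in> {a<..<b} - N \<Longrightarrow> s \<le> t \<Longrightarrow> u t - u s = integral {s..t} v"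
    using weak_deriv_imp_integral[OF assms] by blast
  show thesis
  proof (cases "{a<..<b} - N = {}")
    case True
    then show thesis using that[OF N(1), of 0] by blast
  next
    case False
    then obtain s where s: "s \<in> {a<..<b} - N" by blast
    have "v integrable_on {a..b}"
      using v by (simp add: integrable_on_Icc_iff_Ioo absolutely_integrable_on_def)
    then have split: "integral {a..x} v + integral {x..y} v = integral {a..y} v"
      if "a \<le> x" "x \<le> y" "y \<le> b" for x y
      using that by (intro Henstock_Kurzweil_Integration.integral_combine)
        (auto intro: integrable_on_subinterval)
    have "u t = u s - integral {a..s} v + integral {a..t} v" if "t \<in> {a<..<b} - N" for t
    proof (cases "s \<le> t")
      case True
      then show ?thesis using N(2)[OF s that] split[of s t] s that by force
    next
      case False
      then show ?thesis using N(2)[OF that s] split[of t s] s that by force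
    qed
    then show thesis by (rule that[OF N(1)])
  qed
qed

text \<open>
  Up to an error \<open>\<epsilon> \<integral> \<bar>g\<bar>\<close>, the claim is local and additive in the interval, so it suffices to
  prove it on short intervals, where the mean value theorem applies.
\<close>

lemma integral_chain_rule:
  fixes P F f g :: "real \<Rightarrow> real"
  assumes ab: "a \<le> b" and g: "g absolutely_integrable_on {a..b}"
    and P: "\<And>x y. a \<le> x \<Longrightarrow> x \<le> y \<Longrightarrow> y \<le> b \<Longrightarrow> P y - P x = integral {x..y} g"
    and F: "\<And>z. (F has_real_derivative f z) (at z)" and f: "continuous_on UNIV f"
  shows "F (P b) - F (P a) = integral {a..b} (\<lambda>x. f (P x) * g x)"
proof -
  have gi: "g integrable_on {a..b}" and ga: "(\<lambda>x. \<bar>g x\<bar>) integrable_on {a..b}"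
    using g by (auto simp: absolutely_integrable_on_def)
  have "continuous_on {a..b} (\<lambda>x. P a + integral {a..x} g)"
    by (intro continuous_intros indefinite_integral_continuous_1 gi)
  moreover have "P a + integral {a..x} g = P x" if "x \<in> {a..b}" for x
    using P[of a x] that by simp
  ultimately have P_cont: "continuous_on {a..b} P"
    using continuous_on_cong[of "{a..b}" "{a..b}" "\<lambda>x. P a + integral {a..x} g" P] by simp
  have fP_cont: "continuous_on {a..b} (\<lambda>x. f (P x))"
    by (rule continuous_on_compose2[OF f P_cont]) auto
  then have "bounded ((\<lambda>x. f (P x)) ` {a..b})"
    by (intro compact_imp_bounded compact_continuous_image) auto
  then obtain B where "\<And>x. x \<in> {a..b} \<Longrightarrow> \<bar>f (P x)\<bar> \<le> B"
    unfolding bounded_iff by fastforce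
  then have "(\<lambda>x. g x * f (P x)) absolutely_integrable_on {a..b}"
    by (intro absolutely_integrable_mult_continuous_bounded[OF g _ fP_cont]) auto
  then have fPg: "(\<lambda>x. f (P x) * g x) integrable_on {a..b}"
    by (simp add: absolutely_integrable_on_def mult.commute)
  \<comment> \<open>\<open>K\<close> is the defect in the chain rule on \<open>{x..y}\<close> and
    \<open>I\<close> the mass of \<open>g\<close> there; both are additive under splitting the
    interval.\<close>
  define K where "K x y = F (P y) - F (P x) - integral {x..y} (\<lambda>x. f (P x) * g x)" for x y
  define I where "I x y = integral {x..y} (\<lambda>x. \<bar>g x\<bar>)" for x y
  \<comment> \<open>The mean value theorem for \<open>F\<close> gives an intermediate value between
    \<open>P x\<close> and \<open>P y\<close>; as \<open>P\<close> is continuous, that value is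
    attained at a point of the interval itself.\<close>
  have mvt: "\<exists>z\<in>{x..y}. F (P y) - F (P x) = f (P z) * (P y - P x)"
    if xy: "a \<le> x" "x \<le> y" "y \<le> b" for x y
  proof -
    have cont: "continuous_on {x..y} P"
      using P_cont xy by (auto intro: continuous_on_subset)
    consider "P x = P y" | "P x < P y" | "P y < P x" by linarith
    then show ?thesis
    proof cases
      case 1
      then show ?thesis using xy by (intro bexI[of _ x]) auto
    next
      case 2
      then obtain \<xi> where \<xi>: "P x < \<xi>" "\<xi> < P y" "F (P y) - F (P x) = (P y - P x) * f \<xi>"
        using MVT2[OF 2, of F f] F by blast
      then obtain z where "x \<le> z" "z \<le> y" "P z = \<xi>"
        using IVT'[of P x \<xi> y] cont xy by auto
      with \<xi> show ?thesis by (intro bexI[of _ z]) auto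
    next
      case 3
      then obtain \<xi> where \<xi>: "P y < \<xi>" "\<xi> < P x" "F (P x) - F (P y) = (P x - P y) * f \<xi>"
        using MVT2[OF 3, of F f] F by blast
      then obtain z where "x \<le> z" "z \<le> y" "P z = \<xi>"
        using IVT2'[of P y \<xi> x] cont xy by auto
      with \<xi> show ?thesis by (intro bexI[of _ z]) (auto simp: algebra_simps)
    qed
  qed
  have K_le: "\<bar>K a b\<bar> \<le> e * I a b" if e: "e > 0" for e
  proof -
    have "a \<le> a \<and> b \<le> b \<and> a \<le> b \<longrightarrow> \<bar>K a b\<bar> \<le> e * I a b"
    \<comment> \<open>Bisection: the estimate passes from two adjacent intervals to their union and
      holds on all short intervals around each point, hence on the whole of \<open>{a..b}\<close>.
      The guards in the predicate confine it to subintervals.\<close>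
    proof (rule Bolzano[of a b "\<lambda>x y. a \<le> x \<and> y \<le> b \<and> x \<le> y \<longrightarrow> \<bar>K x y\<bar> \<le> e * I x y"])
      fix x y z
      assume Q: "a \<le> x \<and> y \<le> b \<and> x \<le> y \<longrightarrow> \<bar>K x y\<bar> \<le> e * I x y"
        "a \<le> y \<and> z \<le> b \<and> y \<le> z \<longrightarrow> \<bar>K y z\<bar> \<le> e * I y z" and le: "x \<le> y" "y \<le> z"
      show "a \<le> x \<and> z \<le> b \<and> x \<le> z \<longrightarrow> \<bar>K x z\<bar> \<le> e * I x z"
      proof
        assume xz: "a \<le> x \<and> z \<le> b \<and> x \<le> z"
        have "(\<lambda>x. f (P x) * g x) integrable_on {x..z}" "(\<lambda>x. \<bar>g x\<bar>) integrable_on {x..z}"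
          using xz fPg ga by (auto intro: integrable_on_subinterval)
        then have "K x z = K x y + K y z" "I x z = I x y + I y z"
          using le by (simp_all add: K_def I_def flip: Henstock_Kurzweil_Integration.integral_combine[of x y z])
        moreover have "\<bar>K x y\<bar> \<le> e * I x y" "\<bar>K y z\<bar> \<le> e * I y z"
          using Q le xz by auto
        ultimately show "\<bar>K x z\<bar> \<le> e * I x z" by (simp add: distrib_left)
      qed
    next
      fix x0 assume x0: "a \<le> x0" "x0 \<le> b"
      then obtain d where d: "d > 0"
        "\<And>z. z \<in> {a..b} \<Longrightarrow> dist z x0 < d \<Longrightarrow> dist (f (P z)) (f (P x0)) < e / 2"
        using fP_cont e unfolding continuous_on_iff
        by (metis atLeastAtMost_iff half_gt_zero)
      have "\<bar>K x y\<bar> \<le> e * I x y"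
        if xy: "x \<le> x0" "x0 \<le> y" "y - x < d" "a \<le> x" "y \<le> b" "x \<le> y" for x y
      proof -
        obtain z where z: "z \<in> {x..y}" "F (P y) - F (P x) = f (P z) * (P y - P x)"
          using mvt xy by blast
        have sub: "g integrable_on {x..y}" "(\<lambda>x. f (P x) * g x) integrable_on {x..y}"
            "(\<lambda>x. \<bar>g x\<bar>) integrable_on {x..y}"
          using xy fPg gi ga by (auto intro: integrable_on_subinterval)
        \<comment> \<open>The increment of \<open>P\<close> is an integral of \<open>g\<close>, so
          the constant factor \<open>f (P z)\<close> goes under the integral. On a short interval it
          differs from \<open>f (P t)\<close> by at most \<open>e\<close>, since both are within
          \<open>e / 2\<close> of \<open>f (P x0)\<close>.\<close>
        have "K x y = integral {x..y} (\<lambda>t. f (P z) * g t) - integral {x..y} (\<lambda>t. f (P t) * g t)"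
          using z(2) P[of x y] xy by (simp add: K_def)
        also have "\<dots> = integral {x..y} (\<lambda>t. f (P z) * g t - f (P t) * g t)"
          using sub by (intro Henstock_Kurzweil_Integration.integral_diff[symmetric]
              integrable_on_mult_right) auto
        finally have K: "K x y = integral {x..y} (\<lambda>t. f (P z) * g t - f (P t) * g t)" .
        have "norm (integral {x..y} (\<lambda>t. f (P z) * g t - f (P t) * g t)) \<le>
            integral {x..y} (\<lambda>t. e * \<bar>g t\<bar>)"
        proof (rule integral_norm_bound_integral)
          show "(\<lambda>t. f (P z) * g t - f (P t) * g t) integrable_on {x..y}"
            using sub by (intro integrable_diff integrable_on_mult_right) auto
          show "(\<lambda>t. e * \<bar>g t\<bar>) integrable_on {x..y}"
            using sub by (intro integrable_on_mult_right) auto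
          fix t assume t: "t \<in> {x..y}"
          have "dist (f (P z)) (f (P x0)) < e / 2" "dist (f (P t)) (f (P x0)) < e / 2"
            using z(1) t xy by (intro d(2); auto simp: dist_real_def)+
          then have "\<bar>f (P z) - f (P t)\<bar> \<le> e" unfolding dist_real_def by linarith
          then have "\<bar>f (P z) - f (P t)\<bar> * \<bar>g t\<bar> \<le> e * \<bar>g t\<bar>"
            by (rule mult_right_mono) auto
          then show "norm (f (P z) * g t - f (P t) * g t) \<le> e * \<bar>g t\<bar>"
            by (simp add: left_diff_distrib[symmetric] abs_mult)
        qed
        then show ?thesis by (simp add: K I_def)
      qed
      with d(1) show "\<exists>d>0. \<forall>x y. x \<le> x0 \<and> x0 \<le> y \<and> y - x < d \<longrightarrow>
          a \<le> x \<and> y \<le> b \<and> x \<le> y \<longrightarrow> \<bar>K x y\<bar> \<le> e * I x y" by blast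
    qed (use ab in auto)
    then show ?thesis using ab by simp
  qed
  have "K a b = 0"
  proof (rule ccontr)
    assume "K a b \<noteq> 0"
    moreover have I: "I a b \<ge> 0"
      unfolding I_def by (rule Henstock_Kurzweil_Integration.integral_nonneg[OF ga]) auto
    \<comment> \<open>This choice of \<open>e\<close> contradicts \<open>K a b \<noteq> 0\<close>;
      the summand 1 keeps the denominator positive and makes the bound strictly smaller than the
      left-hand side.\<close>
    ultimately have "\<bar>K a b\<bar> \<le> \<bar>K a b\<bar> / (I a b + 1) * I a b"
      by (intro K_le) auto
    then have "\<bar>K a b\<bar> * (I a b + 1) \<le> \<bar>K a b\<bar> * I a b"
      using I by (simp add: field_simps)
    with \<open>K a b \<noteq> 0\<close> show False by (simp add: distrib_left)
  qed
  then show ?thesis by (simp add: K_def)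
qed

subsection \<open>Pointwise bounds\<close>

text \<open>Otherwise \<open>g\<close> is at least \<open>k\<close> off a null set, and integrating
  contradicts \<open>less\<close>. The point is sought outside \<open>N\<close> so that identities
  known only almost everywhere can be used at it.\<close>

lemma exists_less_average:
  fixes g :: "real \<Rightarrow> real"
  assumes g: "g integrable_on {a<..<b}" and N: "negligible N" and ab: "a \<le> b"
    and less: "integral {a<..<b} g < k * (b - a)"
  shows "\<exists>x\<in>{a<..<b} - N. g x < k"
proof (rule ccontr)
  assume "\<not> ?thesis"
  then have ge: "k \<le> g x" if "x \<in> {a<..<b} - N" for x using that by (auto simp: not_less)
  have "((\<lambda>x. k) has_integral k * (b - a)) {a<..<b}"
    using has_integral_const_real[of k a b] ab by (simp add: has_integral_Icc_iff_Ioo mult.commute)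
  \<comment> \<open>Resetting \<open>g\<close> to \<open>k\<close> on the null set makes the
    comparison hold at every point without changing the integral.\<close>
  moreover have "((\<lambda>x. if x \<in> N then k else g x) has_integral integral {a<..<b} g) {a<..<b}"
    by (rule has_integral_spike[OF N _ integrable_integral[OF g]]) auto
  ultimately have "k * (b - a) \<le> integral {a<..<b} g"
    by (rule has_integral_le) (use ge in auto)
  with less show False by simp
qed

lemma abs_arsinh_real: "\<bar>arsinh x\<bar> = arsinh \<bar>x :: real\<bar>"
  by (cases "x \<ge> 0") (auto simp: abs_if)

text \<open>As \<open>arsinh\<close> has derivative \<open>1 / sqrt (z\<^sup>2 + 1)\<close>, the
  oscillation of \<open>arsinh p\<close> is controlled by the integral of
  \<open>\<bar>q\<bar> / R\<close>. The constant adds this oscillation bound to the value of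
  \<open>arsinh\<close> at a threshold for \<open>R\<close> near its average; applying
  \<open>sinh\<close> returns to \<open>p\<close>.\<close>

lemma weak_deriv_sup_bound:
  fixes p q :: "real \<Rightarrow> real"
  defines "R \<equiv> \<lambda>x. sqrt (1 + (p x)\<^sup>2)"
  assumes wd: "has_weak_deriv {a<..<b} p q" and ab: "a < b"
    and p: "p absolutely_integrable_on {a<..<b}" and q: "q absolutely_integrable_on {a<..<b}"
    and R: "R integrable_on {a<..<b}" and E: "(\<lambda>x. (q x)\<^sup>2 / R x ^ 3) integrable_on {a<..<b}"
    and c1: "integral {a<..<b} R \<le> c1" and c2: "integral {a<..<b} (\<lambda>x. (q x)\<^sup>2 / R x ^ 3) \<le> c2"
  shows "\<exists>N. negligible N \<and>
    (\<forall>x\<in>{a<..<b} - N. \<bar>p x\<bar> \<le> sinh (arsinh (c1 / (b - a) + 1) + (c1 + c2) / 2))"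
proof -
  let ?\<Omega> = "{a<..<b}"
  have R_pos: "R x > 0" for x by (simp add: R_def add_pos_nonneg)
  obtain N c where N: "negligible N" "\<And>t. t \<in> ?\<Omega> - N \<Longrightarrow> p t = c + integral {a..t} q"
    by (rule weak_deriv_eq_integral[OF wd p q]) (rule that)
  \<comment> \<open>The continuous representative of \<open>p\<close>: the chain rule requires the
    integral identity at all points, whereas \<open>p\<close> satisfies it only outside
    \<open>N\<close>.\<close>
  define P where "P t = c + integral {a..t} q" for t
  have p_eq: "p t = P t" if "t \<in> ?\<Omega> - N" for t using N(2)[OF that] by (simp add: P_def)
  have q_int: "q integrable_on {a..b}"
    using q by (simp add: integrable_on_Icc_iff_Ioo absolutely_integrable_on_def)
  have P_diff: "P y - P x = integral {x..y} q" if "a \<le> x" "x \<le> y" "y \<le> b" for x y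
  proof -
    have "q integrable_on {a..y}"
      using q_int by (rule integrable_on_subinterval) (use that in auto)
    from Henstock_Kurzweil_Integration.integral_combine[OF that(1,2) this]
    show ?thesis by (simp add: P_def)
  qed
  define e where "e x = ((q x)\<^sup>2 / R x ^ 3 + R x) / 2" for x
  have e_nonneg: "e x \<ge> 0" for x using R_pos[of x] by (simp add: e_def)
  have e_int: "e integrable_on ?\<Omega>"
    unfolding e_def by (intro integrable_on_divide integrable_add E R)
  have e_le: "integral ?\<Omega> e \<le> (c1 + c2) / 2"
    unfolding e_def using c1 c2 by (simp add: Henstock_Kurzweil_Integration.integral_add[OF E R])
  \<comment> \<open>The inequality of arithmetic and geometric means for the squares
    \<open>q\<^sup>2 / R ^ 3\<close> and \<open>R\<close>, whose product is
    \<open>(q / R)\<^sup>2\<close>.\<close>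
  have amgm: "\<bar>q x\<bar> / R x \<le> e x" for x
  proof -
    have "0 \<le> (\<bar>q x\<bar> - (R x)\<^sup>2)\<^sup>2 / (2 * R x ^ 3)" using R_pos[of x] by simp
    also have "\<dots> = e x - \<bar>q x\<bar> / R x"
      using R_pos[of x]
      by (simp add: e_def power2_diff field_simps) (simp add: eval_nat_numeral algebra_simps)
    finally show ?thesis by simp
  qed
  have osc: "\<bar>arsinh (P y) - arsinh (P x)\<bar> \<le> (c1 + c2) / 2"
    if xy: "x \<in> ?\<Omega>" "y \<in> ?\<Omega>" "x \<le> y" for x y
  proof -
    have sub: "{x..y} \<subseteq> ?\<Omega>" using xy by auto
    have cont: "continuous_on UNIV (\<lambda>z. 1 / sqrt (z\<^sup>2 + 1) :: real)"
    proof (intro continuous_intros ballI)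
      show "sqrt (z\<^sup>2 + 1) \<noteq> 0" for z :: real
        using zero_le_power2[of z] by (simp add: add_nonneg_eq_0_iff)
    qed
    have q': "q absolutely_integrable_on {x..y}"
      by (rule set_integrable_subset[OF q _ sub]) simp
    have eq: "arsinh (P y) - arsinh (P x) = integral {x..y} (\<lambda>t. 1 / sqrt ((P t)\<^sup>2 + 1) * q t)"
      by (rule integral_chain_rule[OF xy(3) q' P_diff _ cont])
        (use xy in \<open>auto intro: arsinh_real_has_field_derivative\<close>)
    also have "\<dots> = integral {x..y} (\<lambda>t. q t / R t)"
      by (rule integral_spike[OF N(1)]) (use p_eq sub in \<open>auto simp: R_def add.commute\<close>)
    also have "norm \<dots> \<le> integral {x..y} e"
    proof (rule integral_norm_bound_integral)
      have "p \<in> borel_measurable (lebesgue_on {x..y})"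
        using set_integrable_subset[OF p _ sub] absolutely_integrable_measurable[of "{x..y}" p] by simp
      then have "(\<lambda>t. 1 / R t) \<in> borel_measurable (lebesgue_on {x..y})"
        unfolding R_def by measurable
      moreover have "bounded ((\<lambda>t. 1 / R t) ` {x..y})"
      proof -
        have "norm (1 / R t) \<le> 1" for t by (simp add: R_def divide_le_eq add_pos_nonneg)
        then show ?thesis by (auto simp only: bounded_iff intro!: exI[of _ 1])
      qed
      ultimately have "(\<lambda>t. 1 / R t * q t) absolutely_integrable_on {x..y}"
        using q' by (intro absolutely_integrable_bounded_measurable_product_real) auto
      then show "(\<lambda>t. q t / R t) integrable_on {x..y}"
        by (simp add: absolutely_integrable_on_def)
      show "e integrable_on {x..y}"
        using e_int sub by (rule integrable_on_subinterval)
      show "norm (q t / R t) \<le> e t" for t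
        using amgm[of t] R_pos[of t] by simp
    qed
    also have "\<dots> \<le> integral ?\<Omega> e"
      by (rule integral_subset_le[OF sub]) (use e_nonneg e_int sub in \<open>auto intro: integrable_on_subinterval\<close>)
    finally show ?thesis using e_le by simp
  qed
  \<comment> \<open>The summand 1 in the threshold makes the comparison with the average strict,
    which yields a point outside \<open>N\<close>.\<close>
  have "c1 < (c1 / (b - a) + 1) * (b - a)" using ab by (simp add: distrib_right)
  then have "\<exists>x\<in>?\<Omega> - N. R x < c1 / (b - a) + 1"
    using c1 ab by (intro exists_less_average[OF R N(1)]) auto
  then obtain x where x: "x \<in> ?\<Omega> - N" "R x < c1 / (b - a) + 1" by blast
  have "\<bar>p x\<bar> \<le> R x" unfolding R_def by (rule real_le_rsqrt) simp
  then have px: "\<bar>arsinh (p x)\<bar> \<le> arsinh (c1 / (b - a) + 1)"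
    unfolding abs_arsinh_real using x(2) by (metis arsinh_less_iff_real less_eq_real_def order_le_less_trans)
  have "\<bar>p y\<bar> \<le> sinh (arsinh (c1 / (b - a) + 1) + (c1 + c2) / 2)" if y: "y \<in> ?\<Omega> - N" for y
  proof -
    have "\<bar>arsinh (P y) - arsinh (P x)\<bar> \<le> (c1 + c2) / 2"
      using osc[of x y] osc[of y x] x y
      by (cases "x \<le> y") (auto simp: abs_minus_commute[of "arsinh (P y)"])
    then have "arsinh \<bar>p y\<bar> \<le> arsinh (c1 / (b - a) + 1) + (c1 + c2) / 2"
      using px unfolding p_eq[OF x(1)] p_eq[OF y] abs_arsinh_real[symmetric] by linarith
    then have "sinh (arsinh \<bar>p y\<bar>) \<le> sinh (arsinh (c1 / (b - a) + 1) + (c1 + c2) / 2)"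
      by (simp only: sinh_real_le_iff)
    then show ?thesis by simp
  qed
  with N(1) show ?thesis by blast
qed

text \<open>Off a null set \<open>u\<close> oscillates by at most \<open>M * (b - a)\<close>. Since
  only the integral of \<open>u\<close> is controlled, not that of its absolute value, the averaging
  argument is applied to \<open>u\<close> and to \<open>- u\<close>: one point yields the upper
  bound, the other the lower bound.\<close>

lemma weak_antiderivative_sup_bound:
  fixes u p :: "real \<Rightarrow> real"
  assumes wd: "has_weak_deriv {a<..<b} u p" and ab: "a < b"
    and u: "u absolutely_integrable_on {a<..<b}" and p: "p absolutely_integrable_on {a<..<b}"
    and c0: "\<bar>integral {a<..<b} u\<bar> \<le> c0"
    and N: "negligible N" and M: "\<And>x. x \<in> {a<..<b} - N \<Longrightarrow> \<bar>p x\<bar> \<le> M"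
  shows "\<exists>N. negligible N \<and> (\<forall>x\<in>{a<..<b} - N. \<bar>u x\<bar> \<le> c0 / (b - a) + 1 + M * (b - a))"
proof -
  let ?\<Omega> = "{a<..<b}"
  obtain N' where N': "negligible N'"
    "\<And>s t. s \<in> ?\<Omega> - N' \<Longrightarrow> t \<in> ?\<Omega> - N' \<Longrightarrow> s \<le> t \<Longrightarrow> u t - u s = integral {s..t} p"
    using weak_deriv_imp_integral[OF wd u p] by blast
  \<comment> \<open>A nonempty open interval is not negligible, so the bound on \<open>p\<close>
    holds at some point, which forces \<open>M\<close> to be nonnegative.\<close>
  have "?\<Omega> - N \<noteq> {}"
    using N negligible_subset[of N ?\<Omega>] ab non_negligible_UNIV open_not_negligible[of ?\<Omega>] by auto
  then have M0: "M \<ge> 0" using M by (meson abs_ge_zero all_not_in_conv order_trans)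
  have osc: "\<bar>u t - u s\<bar> \<le> M * (b - a)"
    if st: "s \<in> ?\<Omega> - N'" "t \<in> ?\<Omega> - N'" "s \<le> t" for s t
  proof -
    have "p integrable_on {s..t}"
      using st p by (intro integrable_on_subinterval[of p ?\<Omega>]) (auto simp: absolutely_integrable_on_def)
    \<comment> \<open>Replacing \<open>p\<close> by 0 on \<open>N\<close> leaves the integral
      unchanged and lets the bound \<open>M\<close> hold at every point.\<close>
    then have "((\<lambda>x. if x \<in> N then 0 else p x) has_integral integral {s..t} p) {s..t}"
      by (intro has_integral_spike[OF N _ integrable_integral]) auto
    then have "norm (integral {s..t} p) \<le> M * measure lborel {s..t}"
      by (rule has_integral_bound_real[OF M0 finite.emptyI]) (use M M0 st in auto)
    also have "\<dots> \<le> M * (b - a)" using st M0 by (intro mult_left_mono) auto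
    finally show ?thesis using N'(2)[OF st] by simp
  qed
  have ui: "u integrable_on ?\<Omega>" using u by (simp add: absolutely_integrable_on_def)
  have c0': "c0 < (c0 / (b - a) + 1) * (b - a)" using ab by (simp add: distrib_right)
  then have "\<exists>s\<in>?\<Omega> - N'. u s < c0 / (b - a) + 1"
    using c0 ab by (intro exists_less_average[OF ui N'(1)]) auto
  then obtain s where s: "s \<in> ?\<Omega> - N'" "u s < c0 / (b - a) + 1" by blast
  have "\<exists>s\<in>?\<Omega> - N'. - u s < c0 / (b - a) + 1"
    using c0 ab c0' by (intro exists_less_average[OF integrable_neg[OF ui] N'(1)]) auto
  then obtain s' where s': "s' \<in> ?\<Omega> - N'" "- u s' < c0 / (b - a) + 1" by blast
  have "\<bar>u t\<bar> \<le> c0 / (b - a) + 1 + M * (b - a)" if t: "t \<in> ?\<Omega> - N'" for t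
  proof -
    have "\<bar>u t - u r\<bar> \<le> M * (b - a)" if "r \<in> ?\<Omega> - N'" for r
      using osc[OF that t] osc[OF t that] by (cases "r \<le> t") (auto simp: abs_minus_commute)
    from this[OF s(1)] this[OF s'(1)] s(2) s'(2) show ?thesis by linarith
  qed
  with N'(1) show ?thesis by blast
qed

subsection \<open>Sobolev norms\<close>

lemma has_weak_deriv_weak_deriv:
  "weakly_differentiable \<Omega> u \<Longrightarrow> has_weak_deriv \<Omega> u (weak_deriv \<Omega> u)"
  unfolding weakly_differentiable_def weak_deriv_def by (metis someI)

lemma Lp_space_2_iff:
  "f \<in> Lp_space \<Omega> 2 \<longleftrightarrow>
    f \<in> borel_measurable (lebesgue_on \<Omega>) \<and> integrable (lebesgue_on \<Omega>) (\<lambda>x. (f x)\<^sup>2)"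
  by (simp add: Lp_space_def powr_numeral)

lemma Lp_norm_2_le:
  assumes "(LINT x|lebesgue_on \<Omega>. (f x)\<^sup>2) \<le> B"
  shows "Lp_norm \<Omega> 2 f \<le> sqrt B"
proof -
  have "Lp_norm \<Omega> 2 f = sqrt (LINT x|lebesgue_on \<Omega>. (f x)\<^sup>2)"
    by (simp add: Lp_norm_def powr_numeral powr_half_sqrt)
  then show ?thesis using assms by simp
qed

lemma Lp_infinity_bound:
  assumes f: "f \<in> borel_measurable (lebesgue_on \<Omega>)" and ae: "AE x in lebesgue_on \<Omega>. \<bar>f x\<bar> \<le> B"
    and B: "0 \<le> B"
  shows "f \<in> Lp_space \<Omega> \<infinity>" "Lp_norm \<Omega> \<infinity> f \<le> B"
proof -
  have "esssup (lebesgue_on \<Omega>) (\<lambda>x. ennreal \<bar>f x\<bar>) \<le> ennreal B"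
    by (rule esssup_I) (use f ae in \<open>auto elim: eventually_mono simp: ennreal_leI\<close>)
  moreover from this have "esssup (lebesgue_on \<Omega>) (\<lambda>x. ennreal \<bar>f x\<bar>) < \<infinity>"
    by (rule order_le_less_trans) (simp add: ennreal_less_top)
  ultimately show "f \<in> Lp_space \<Omega> \<infinity>" "Lp_norm \<Omega> \<infinity> f \<le> B"
    using f B by (simp_all add: Lp_space_def Lp_norm_def enn2real_leI)
qed

text \<open>On a finite measure space \<open>1 + (f x)\<^sup>2\<close> is integrable, and it
  dominates \<open>\<bar>f x\<bar>\<close>.\<close>

lemma integrable_of_square:
  fixes f :: "'a \<Rightarrow> real"
  assumes "finite_measure M" "f \<in> borel_measurable M" "integrable M (\<lambda>x. (f x)\<^sup>2)"
  shows "integrable M f"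
proof (rule Bochner_Integration.integrable_bound)
  interpret finite_measure M by fact
  show "integrable M (\<lambda>x. 1 + (f x)\<^sup>2)" using assms by simp
  have "\<bar>y\<bar> \<le> 1 + y\<^sup>2" for y :: real
    using zero_le_power2[of "\<bar>y\<bar> - 1"] unfolding power2_diff power2_abs by simp
  then show "AE x in M. norm (f x) \<le> norm (1 + (f x)\<^sup>2)" by simp
qed fact

section \<open>Transfer to the restricted Lebesgue measure, and uniform bounds\<close>

lemma absolutely_integrable_on_iff_integrable:
  "S \<in> sets lebesgue \<Longrightarrow> f absolutely_integrable_on S \<longleftrightarrow> integrable (lebesgue_on S) f"
  by (simp add: set_integrable_def integrable_restrict_space)

lemma LINT_lebesgue_on:
  fixes f :: "real \<Rightarrow> real"
  assumes "S \<in> sets lebesgue"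
  shows "(LINT x:S|lebesgue. f x) = (LINT x|lebesgue_on S. f x)"
  unfolding set_lebesgue_integral_def
  by (rule Bochner_Integration.integral_restrict_space[symmetric]) (use assms in simp)

lemma AE_lebesgue_on_negligible:
  assumes "negligible N" "\<And>x. x \<in> S - N \<Longrightarrow> Q x" "S \<in> sets lebesgue"
  shows "AE x in lebesgue_on S. Q x"
proof -
  have "AE x in lebesgue. x \<notin> N"
    using assms(1) by (intro AE_not_in) (simp add: negligible_iff_null_sets)
  then have "AE x in lebesgue. x \<in> S \<longrightarrow> Q x"
    by eventually_elim (use assms in auto)
  then show ?thesis using assms(3) by (simp add: AE_restrict_space_iff)
qed

lemma LINT_square_le:
  fixes f :: "real \<Rightarrow> real"
  assumes "a \<le> b" "integrable (lebesgue_on {a<..<b}) (\<lambda>x. (f x)\<^sup>2)"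
    and "AE x in lebesgue_on {a<..<b}. \<bar>f x\<bar> \<le> B"
  shows "(LINT x|lebesgue_on {a<..<b}. (f x)\<^sup>2) \<le> B\<^sup>2 * (b - a)"
proof -
  interpret finite_measure "lebesgue_on {a<..<b}"
    by (rule finite_measure_lebesgue_on) simp
  have "AE x in lebesgue_on {a<..<b}. (f x)\<^sup>2 \<le> B\<^sup>2"
    using assms(3)
  proof eventually_elim
    case (elim x)
    then show ?case by (metis abs_ge_zero power2_abs power_mono)
  qed
  then have "(LINT x|lebesgue_on {a<..<b}. (f x)\<^sup>2) \<le> (LINT x|lebesgue_on {a<..<b}. B\<^sup>2)"
    using assms(2) by (intro integral_mono_AE) auto
  also have "\<dots> = B\<^sup>2 * (b - a)"
    using assms(1) by (simp add: measure_restrict_space mult.commute)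
  finally show ?thesis .
qed

text \<open>\<open>M\<close> bounds the first weak derivative and \<open>A\<close> bounds
  \<open>u\<close>, both almost everywhere. The bounds on the norms are explicit in
  \<open>l\<close>, \<open>c0\<close>, \<open>c1\<close>, \<open>c2\<close> alone and do not involve
  \<open>u\<close>; this is the source of uniformity over a family.\<close>

lemma sobolev_bounds:
  fixes l c0 c1 c2 :: real
  defines "M \<equiv> sinh (arsinh (c1 / (2 * l) + 1) + (c1 + c2) / 2)"
  defines "A \<equiv> c0 / (2 * l) + 1 + M * (2 * l)"
  assumes l: "l > 0" and \<Omega>: "\<Omega> = {-l<..<l}" and u: "u \<in> sobolev_space \<Omega> 2 2"
    and c0: "\<bar>LINT x:\<Omega>|lebesgue. u x\<bar> \<le> c0"
    and c1: "(LINT x:\<Omega>|lebesgue. sqrt (1 + \<bar>weak_deriv \<Omega> u x\<bar>\<^sup>2)) \<le> c1"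
    and c2: "(LINT x:\<Omega>|lebesgue. \<bar>weak_deriv \<Omega> (weak_deriv \<Omega> u) x\<bar>\<^sup>2 /
        (sqrt (1 + \<bar>weak_deriv \<Omega> u x\<bar>\<^sup>2)) ^ 3) \<le> c2"
  shows "u \<in> sobolev_space \<Omega> 1 \<infinity>"
    and "sobolev_norm \<Omega> 1 \<infinity> u \<le> A + M"
    and "sobolev_norm \<Omega> 2 2 u \<le>
      sqrt (A\<^sup>2 * (2 * l)) + sqrt (M\<^sup>2 * (2 * l)) + sqrt (sqrt (1 + M\<^sup>2) ^ 3 * c2)"
proof -
  define p where "p = weak_deriv \<Omega> u"
  define q where "q = weak_deriv \<Omega> p"
  define R where "R x = sqrt (1 + (p x)\<^sup>2)" for x
  let ?M = "lebesgue_on \<Omega>"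
  have \<Omega>_sets [simp]: "\<Omega> \<in> sets lebesgue" by (simp add: \<Omega>)
  interpret finite_measure ?M
    unfolding \<Omega> by (rule finite_measure_lebesgue_on) simp
  have iter: "(weak_deriv \<Omega> ^^ 0) u = u" "(weak_deriv \<Omega> ^^ 1) u = p" "(weak_deriv \<Omega> ^^ 2) u = q"
    by (simp_all add: p_def q_def numeral_2_eq_2)
  have "weakly_differentiable \<Omega> u" "weakly_differentiable \<Omega> p"
    using u iter unfolding sobolev_space_def
    by (metis (mono_tags, lifting) mem_Collect_eq one_less_numeral_iff pos2 semiring_norm(76))+
  then have wd: "has_weak_deriv \<Omega> u p" "has_weak_deriv \<Omega> p q"
    unfolding p_def q_def by (auto intro: has_weak_deriv_weak_deriv)
  have "u \<in> Lp_space \<Omega> 2" "p \<in> Lp_space \<Omega> 2" "q \<in> Lp_space \<Omega> 2"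
    using u iter unfolding sobolev_space_def
    by (metis (mono_tags, lifting) mem_Collect_eq one_le_numeral zero_le le_refl)+
  then have [measurable]: "u \<in> borel_measurable ?M" "p \<in> borel_measurable ?M" "q \<in> borel_measurable ?M"
    and sq: "integrable ?M (\<lambda>x. (u x)\<^sup>2)" "integrable ?M (\<lambda>x. (p x)\<^sup>2)" "integrable ?M (\<lambda>x. (q x)\<^sup>2)"
    by (auto simp: Lp_space_2_iff)
  have int: "integrable ?M u" "integrable ?M p" "integrable ?M q"
    using sq by (auto intro!: integrable_of_square finite_measure_axioms)
  have ai: "u absolutely_integrable_on \<Omega>" "p absolutely_integrable_on \<Omega>" "q absolutely_integrable_on \<Omega>"
    using int by (simp_all add: absolutely_integrable_on_iff_integrable)
  have R_ge: "1 \<le> R x" for x by (simp add: R_def)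
  have [measurable]: "R \<in> borel_measurable ?M" unfolding R_def by measurable
  \<comment> \<open>The square of \<open>R\<close> is \<open>1 + (p x)\<^sup>2\<close>, integrable
    because the interval has finite measure.\<close>
  have R: "integrable ?M R"
    by (rule integrable_of_square) (use sq in \<open>auto simp: R_def finite_measure_axioms add_nonneg_nonneg\<close>)
  have E: "integrable ?M (\<lambda>x. (q x)\<^sup>2 / R x ^ 3)"
  proof (rule Bochner_Integration.integrable_bound[OF sq(3)])
    have "(q x)\<^sup>2 / R x ^ 3 \<le> (q x)\<^sup>2 / 1" for x
      using R_ge[of x] by (intro divide_left_mono) (auto simp: one_le_power)
    then show "AE x in ?M. norm ((q x)\<^sup>2 / R x ^ 3) \<le> norm ((q x)\<^sup>2)"
      using R_ge by (auto simp: abs_of_nonneg order_trans[OF zero_le_one])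
  qed measurable
  have c0': "\<bar>LINT x|?M. u x\<bar> \<le> c0" and c1': "(LINT x|?M. R x) \<le> c1"
    and c2': "(LINT x|?M. (q x)\<^sup>2 / R x ^ 3) \<le> c2"
    using c0 c1 c2 by (simp_all add: LINT_lebesgue_on R_def p_def q_def)
  have "\<exists>N. negligible N \<and> (\<forall>x\<in>{-l<..<l} - N. \<bar>p x\<bar> \<le>
      sinh (arsinh (c1 / (l - - l) + 1) + (c1 + c2) / 2))"
    by (rule weak_deriv_sup_bound[of "-l" l p q])
      (use wd ai R E c1' c2' l in \<open>auto simp: \<Omega> R_def[abs_def] integrable_on_lebesgue_on
        simp flip: lebesgue_integral_eq_integral\<close>)
  then obtain N where N: "negligible N" "\<And>x. x \<in> \<Omega> - N \<Longrightarrow> \<bar>p x\<bar> \<le> M"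
    by (auto simp: M_def \<Omega>)
  have "\<exists>N. negligible N \<and> (\<forall>x\<in>{-l<..<l} - N. \<bar>u x\<bar> \<le> c0 / (l - - l) + 1 + M * (l - - l))"
    by (rule weak_antiderivative_sup_bound[of "-l" l u p _ N])
      (use wd ai int c0' l N in \<open>auto simp: \<Omega> simp flip: lebesgue_integral_eq_integral\<close>)
  then obtain N' where N': "negligible N'" "\<And>x. x \<in> \<Omega> - N' \<Longrightarrow> \<bar>u x\<bar> \<le> A"
    by (auto simp: A_def \<Omega>)
  have p_AE: "AE x in ?M. \<bar>p x\<bar> \<le> M"
    by (rule AE_lebesgue_on_negligible[OF N]) auto
  have u_AE: "AE x in ?M. \<bar>u x\<bar> \<le> A"
    by (rule AE_lebesgue_on_negligible[OF N']) auto
  \<comment> \<open>The constants bound nonnegative quantities, so they are nonnegative themselves.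
    This gives \<open>M \<ge> 0\<close> and \<open>A \<ge> 0\<close>, which the passage to the
    essential supremum requires.\<close>
  have c1_nonneg: "c1 \<ge> 0"
    using c1' R_ge by (intro order_trans[OF _ c1'] Bochner_Integration.integral_nonneg)
      (meson order_trans zero_le_one)
  have c2_nonneg: "c2 \<ge> 0"
    using R_ge by (intro order_trans[OF _ c2'] Bochner_Integration.integral_nonneg)
      (simp add: order_trans[OF zero_le_one])
  have c0_nonneg: "c0 \<ge> 0" using c0' by linarith
  have arsinh_pos: "arsinh (c1 / (2 * l) + 1) > 0"
    unfolding arsinh_real_pos_iff using c1_nonneg l by (intro add_nonneg_pos) auto
  have M0: "M \<ge> 0"
    unfolding M_def sinh_real_nonneg_iff
    by (intro add_nonneg_nonneg less_imp_le[OF arsinh_pos]) (use c1_nonneg c2_nonneg in simp)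
  have A0: "A \<ge> 0"
    unfolding A_def using c0_nonneg M0 l by (intro add_nonneg_nonneg) auto
  note Lu = Lp_infinity_bound[OF \<open>u \<in> borel_measurable ?M\<close> u_AE A0]
  note Lp = Lp_infinity_bound[OF \<open>p \<in> borel_measurable ?M\<close> p_AE M0]
  show "u \<in> sobolev_space \<Omega> 1 \<infinity>"
    using \<open>weakly_differentiable \<Omega> u\<close> Lu(1) Lp(1) by (auto simp: sobolev_space_def le_Suc_eq p_def)
  show "sobolev_norm \<Omega> 1 \<infinity> u \<le> A + M"
    using Lu(2) Lp(2) by (simp add: sobolev_norm_def p_def)
  have "(LINT x|?M. (u x)\<^sup>2) \<le> A\<^sup>2 * (2 * l)"
    using LINT_square_le[of "-l" l u A] l sq(1) u_AE unfolding \<Omega> by simp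
  moreover have "(LINT x|?M. (p x)\<^sup>2) \<le> M\<^sup>2 * (2 * l)"
    using LINT_square_le[of "-l" l p M] l sq(2) p_AE unfolding \<Omega> by simp
  moreover have "(LINT x|?M. (q x)\<^sup>2) \<le> sqrt (1 + M\<^sup>2) ^ 3 * c2"
  proof -
    \<comment> \<open>Almost everywhere \<open>\<bar>p x\<bar> \<le> M\<close>, so
      \<open>R x ^ 3\<close> is at most \<open>sqrt (1 + M\<^sup>2) ^ 3\<close>; at the price of
      this factor the weight is introduced under the integral, and the hypothesis on the weighted
      energy applies.\<close>
    have "(LINT x|?M. (q x)\<^sup>2) \<le> (LINT x|?M. sqrt (1 + M\<^sup>2) ^ 3 * ((q x)\<^sup>2 / R x ^ 3))"
    proof (rule integral_mono_AE[OF sq(3)])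
      show "AE x in ?M. (q x)\<^sup>2 \<le> sqrt (1 + M\<^sup>2) ^ 3 * ((q x)\<^sup>2 / R x ^ 3)"
        using p_AE
      proof eventually_elim
        case (elim x)
        then have "(p x)\<^sup>2 \<le> M\<^sup>2" by (metis abs_ge_zero power2_abs power_mono)
        then have "R x ^ 3 \<le> sqrt (1 + M\<^sup>2) ^ 3"
          using R_ge[of x] by (intro power_mono) (auto simp: R_def)
        then have "(q x)\<^sup>2 * R x ^ 3 \<le> (q x)\<^sup>2 * sqrt (1 + M\<^sup>2) ^ 3"
          by (rule mult_left_mono) simp
        then show ?case using R_ge[of x] by (simp add: field_simps)
      qed
    qed (rule integrable_mult_right, rule E)
    also have "\<dots> = sqrt (1 + M\<^sup>2) ^ 3 * (LINT x|?M. (q x)\<^sup>2 / R x ^ 3)"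
      by (rule integral_mult_right_zero)
    also have "\<dots> \<le> sqrt (1 + M\<^sup>2) ^ 3 * c2"
      by (rule mult_left_mono[OF c2']) simp
    finally show ?thesis .
  qed
  ultimately show "sobolev_norm \<Omega> 2 2 u \<le>
      sqrt (A\<^sup>2 * (2 * l)) + sqrt (M\<^sup>2 * (2 * l)) + sqrt (sqrt (1 + M\<^sup>2) ^ 3 * c2)"
    using Lp_norm_2_le[of \<Omega> u] Lp_norm_2_le[of \<Omega> p] Lp_norm_2_le[of \<Omega> q] iter
    by (simp add: sobolev_norm_def numeral_2_eq_2 add_mono del: funpow.simps)
qed

theorem lemma4p2:
  fixes l c0 c1 c2 :: real and \<Omega> :: "real set" and u :: "real \<Rightarrow> real \<Rightarrow> real"
  assumes "l > 0"
    and "\<Omega> = {-l<..<l}"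
    and "\<And>\<delta>. \<delta> > 0 \<Longrightarrow> u \<delta> \<in> sobolev_space \<Omega> 2 2"
    and "\<And>\<delta>. \<delta> > 0 \<Longrightarrow> \<bar>LINT x:\<Omega>|lebesgue. u \<delta> x\<bar> \<le> c0"
    and "\<And>\<delta>. \<delta> > 0 \<Longrightarrow>
      (LINT x:\<Omega>|lebesgue. sqrt (1 + \<bar>weak_deriv \<Omega> (u \<delta>) x\<bar>\<^sup>2)) \<le> c1"
    and "\<And>\<delta>. \<delta> > 0 \<Longrightarrow>
      (LINT x:\<Omega>|lebesgue. \<bar>weak_deriv \<Omega> (weak_deriv \<Omega> (u \<delta>)) x\<bar>\<^sup>2 /
        (sqrt (1 + \<bar>weak_deriv \<Omega> (u \<delta>) x\<bar>\<^sup>2)) ^ 3) \<le> c2"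
  shows "\<exists>C. \<forall>\<delta>>0. u \<delta> \<in> sobolev_space \<Omega> 1 \<infinity> \<inter> sobolev_space \<Omega> 2 2 \<and>
           sobolev_norm \<Omega> 1 \<infinity> (u \<delta>) \<le> C \<and> sobolev_norm \<Omega> 2 2 (u \<delta>) \<le> C"
proof -
  \<comment> \<open>The two explicit bounds of \<open>sobolev_bounds\<close> contain no
    \<open>\<delta>\<close>, so they can be chosen before \<open>\<delta>\<close>; their maximum
    serves as \<open>C\<close>.\<close>
  obtain B1 B2 where "\<And>\<delta>. \<delta> > 0 \<Longrightarrow> u \<delta> \<in> sobolev_space \<Omega> 1 \<infinity> \<and>
      sobolev_norm \<Omega> 1 \<infinity> (u \<delta>) \<le> B1 \<and> sobolev_norm \<Omega> 2 2 (u \<delta>) \<le> B2"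
    using sobolev_bounds[OF assms] by metis
  then show ?thesis
    using assms(3) by (intro exI[of _ "max B1 B2"]) (auto simp: le_max_iff_disj)
qed

end
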